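(* Let $d\ge2$ and let $P=\{p_1,\ldots,p_d\}$, $Q=\{q_1,\ldots,q_d\}$ be posets possessing a common linear extension. The following are equivalent: (i) $\Gamma(\mathcal{O}(P),-\mathcal{O}(Q))$ is $\mathbb{Q}$-factorial; (ii) $\Gamma(\mathcal{O}(P),-\mathcal{O}(Q))$ is smooth; (iii) there is a permutation $i_1,\ldots,i_d$ of $[d]$ such that the set of nonempty poset ideals of $P$ is either $\{\{p_{i_1}\},\{p_{i_1},p_{i_2}\},\ldots,\{p_{i_1},\ldots,p_{i_d}\}\}$ or $\{\{p_{i_1}\},\{p_{i_2}\},\{p_{i_1},p_{i_2}\},\ldots,\{p_{i_1},\ldots,p_{i_d}\}\}$, and the set of nonempty poset ideals of $Q$ is either $\{\{q_{i_1}\},\{q_{i_1},q_{i_2}\},\ldots,\{q_{i_1},\ldots,q_{i_d}\}\}$ or $\{\{q_{i_1}\},\{q_{i_2}\},\{q_{i_1},q_{i_2}\},\ldots,\{q_{i_1},\ldots,q_{i_d}\}\}$.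
   Context: For $S\subset P$ (resp. $Q$), $\rho(S)=\sum_{p_i\in S}\mathbf{e}_i$ (resp. $\sum_{q_i\in S}\mathbf{e}_i$). $\Gamma(\mathcal{O}(P),-\mathcal{O}(Q))$ is the convex hull in $\mathbb{R}^d$ of $\{\rho(I):I\text{ poset ideal of }P\}\cup\{-\rho(J):J\text{ poset ideal of }Q\}$. $P$ and $Q$ possess a common linear extension if there is a permutation $j_1\cdots j_d$ of $[d]$ with $a<b$ whenever $p_{j_a}<p_{j_b}$ or $q_{j_a}<q_{j_b}$; under this hypothesis the polytope is a $d$-dimensional Fano polytope (origin is the unique interior lattice point). A Fano polytope is $\mathbb{Q}$-factorial if it is simplicial, and smooth if the vertices of each facet form a $\mathbb{Z}$-basis of $\mathbb{Z}^d$. *)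

theory Defs
  imports "HOL-Analysis.Analysis"
begin

text \<open>
  A poset \<open>{p\<^sub>1, \<dots>, p\<^sub>d}\<close> is given by its (reflexive) order relation on the index type \<open>'n\<close>
  with \<open>d = CARD('n)\<close>: \<open>(i, j) \<in> P\<close> means that \<open>p\<^sub>i \<le> p\<^sub>j\<close>. A permutation \<open>j\<^sub>1 \<cdots> j\<^sub>d\<close>
  of the index set is a bijection from \<open>{1..CARD('n)}\<close> to \<open>'n\<close>.
\<close>

definition poset_ideal :: "'n rel \<Rightarrow> 'n set \<Rightarrow> bool" where
  "poset_ideal P I \<longleftrightarrow> (\<forall>x y. x \<in> I \<longrightarrow> (y, x) \<in> P \<longrightarrow> y \<in> I)"

definition index_permutation :: "(nat \<Rightarrow> 'n::finite) \<Rightarrow> bool" where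
  "index_permutation j \<longleftrightarrow> bij_betw j {1..CARD('n)} UNIV"

definition common_linear_extension :: "'n::finite rel \<Rightarrow> 'n rel \<Rightarrow> bool" where
  "common_linear_extension P Q \<longleftrightarrow>
     (\<exists>j. index_permutation j \<and>
        (\<forall>a\<in>{1..CARD('n)}. \<forall>b\<in>{1..CARD('n)}.
           ((j a, j b) \<in> P \<and> j a \<noteq> j b) \<or> ((j a, j b) \<in> Q \<and> j a \<noteq> j b) \<longrightarrow> a < b))"

definition \<rho> :: "'n::finite set \<Rightarrow> real ^ 'n" where
  "\<rho> S = (\<Sum>i\<in>S. axis i 1)"

definition \<Gamma> :: "'n::finite rel \<Rightarrow> 'n rel \<Rightarrow> (real ^ 'n) set" where
  "\<Gamma> P Q = convex hull ({\<rho> I |I. poset_ideal P I} \<union> {- \<rho> J |J. poset_ideal Q J})"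

definition int_lattice :: "(real ^ 'n) set" where
  "int_lattice = {v. \<forall>i. v $ i \<in> \<int>}"

definition vertices :: "(real ^ 'n) set \<Rightarrow> (real ^ 'n) set" where
  "vertices K = {v. v extreme_point_of K}"

definition fano_polytope :: "(real ^ 'n) set \<Rightarrow> bool" where
  "fano_polytope K \<longleftrightarrow>
     polytope K \<and> vertices K \<subseteq> int_lattice \<and> aff_dim K = int CARD('n) \<and>
     interior K \<inter> int_lattice = {0}"

definition simplicial_polytope :: "(real ^ 'n) set \<Rightarrow> bool" where
  "simplicial_polytope K \<longleftrightarrow> polytope K \<and> (\<forall>F. F facet_of K \<longrightarrow> (\<exists>k. k simplex F))"

definition Q_factorial_fano :: "(real ^ 'n) set \<Rightarrow> bool" where
  "Q_factorial_fano K \<longleftrightarrow> fano_polytope K \<and> simplicial_polytope K"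

global_interpretation int_module: module "\<lambda>(k::int) (v::real ^ 'n). of_int k *\<^sub>R v"
  by unfold_locales (simp_all add: scaleR_add_right scaleR_add_left)

definition int_basis :: "(real ^ 'n) set \<Rightarrow> bool" where
  "int_basis B \<longleftrightarrow> int_module.independent B \<and> int_module.span B = int_lattice"

definition smooth_fano :: "(real ^ 'n) set \<Rightarrow> bool" where
  "smooth_fano K \<longleftrightarrow> fano_polytope K \<and> (\<forall>F. F facet_of K \<longrightarrow> int_basis (vertices F))"

text \<open>The two families \<open>{i\<^sub>1}, {i\<^sub>1, i\<^sub>2}, \<dots>\<close> and \<open>{i\<^sub>1}, {i\<^sub>2}, {i\<^sub>1, i\<^sub>2}, \<dots>\<close>.\<close>

definition initial_segments :: "(nat \<Rightarrow> 'n::finite) \<Rightarrow> 'n set set" where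
  "initial_segments i = {i ` {1..k} |k. k \<in> {1..CARD('n)}}"

definition initial_segments' :: "(nat \<Rightarrow> 'n::finite) \<Rightarrow> 'n set set" where
  "initial_segments' i = insert {i 2} (initial_segments i)"

definition nonempty_ideals :: "'n rel \<Rightarrow> 'n set set" where
  "nonempty_ideals P = {I. poset_ideal P I \<and> I \<noteq> {}}"

end

theory Submission
  imports Defs
begin

text \<open>
  If the polytope is \<open>\<rat>\<close>-factorial or smooth, no facet contains four vertices with
  \<open>v\<^sub>1 + v\<^sub>2 = v\<^sub>3 + v\<^sub>4\<close>. As \<open>\<rho> I + \<rho> I' = \<rho> (I \<union> I') + \<rho> (I \<inter> I')\<close>, intersecting ideals of either poset
  must be comparable, and such a family of ideals is determined along a common linear extension.

  Conversely let \<open>u\<^sub>k\<close> be the indicator vector of \<open>{i\<^sub>1, \<dots>, i\<^sub>k}\<close>, a \<open>\<int>\<close>-basis. The polytope is the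
  hull of \<open>0\<close>, all \<open>\<plusminus>u\<^sub>k\<close> and possibly \<open>\<plusminus>(u\<^sub>2 - u\<^sub>1)\<close>. On a facet \<open>a \<bullet> x = b\<close> with \<open>b \<noteq> 0\<close> one of the
  pairs \<open>\<plusminus>u\<^sub>1\<close>, \<open>\<plusminus>u\<^sub>2\<close>, \<open>\<plusminus>(u\<^sub>2 - u\<^sub>1)\<close> is missing, since \<open>\<plusminus>b \<plusminus> b \<noteq> \<plusminus>b\<close>. Hence the generators on the facet
  are, up to sign, members of a single \<open>\<int>\<close>-basis, and since they span they are a \<open>\<int>\<close>-basis
  themselves.
\<close>

section \<open>Indicator vectors of index sets\<close>

lemma \<rho>_nth: "\<rho> S $ i = of_bool (i \<in> S)"
  by (simp add: \<rho>_def axis_def sum_component of_bool_def)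

lemma inner_\<rho>: "c \<bullet> \<rho> S = (\<Sum>i\<in>S. c $ i)"
  by (simp add: \<rho>_def inner_sum_right inner_axis)

lemma inj_\<rho>: "\<rho> S = \<rho> T \<longleftrightarrow> S = T"
proof
  assume "\<rho> S = \<rho> T"
  then have "of_bool (i \<in> S) = (of_bool (i \<in> T) :: real)" for i
    by (metis \<rho>_nth)
  then show "S = T" by (metis of_bool_eq_iff set_eqI)
qed simp

lemma \<rho>_empty [simp]: "\<rho> {} = 0"
  by (simp add: \<rho>_def)

lemma \<rho>_Un_Int: "\<rho> S + \<rho> T = \<rho> (S \<union> T) + \<rho> (S \<inter> T)"
  by (simp add: \<rho>_def sum.union_inter)

section \<open>Supporting hyperplanes of hulls of finite sets\<close>

text \<open>A face of the hull of a finite set is the hull of some of its generators, and these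
  generators must lie on the hyperplane that cuts out the face.\<close>

lemma convex_hull_supporting_hyperplane:
  fixes a :: "'a::euclidean_space"
  assumes "finite V" and "\<And>v. v \<in> V \<Longrightarrow> a \<bullet> v \<le> b"
  shows "convex hull V \<subseteq> {x. a \<bullet> x \<le> b}"
    and "convex hull V \<inter> {x. a \<bullet> x = b} = convex hull (V \<inter> {x. a \<bullet> x = b})"
proof -
  show sub: "convex hull V \<subseteq> {x. a \<bullet> x \<le> b}"
    using assms(2) by (intro hull_minimal) (auto simp: convex_halfspace_le)
  then have "(convex hull V \<inter> {x. a \<bullet> x = b}) face_of (convex hull V)"
    by (intro face_of_Int_supporting_hyperplane_le) auto
  then obtain S where S: "S \<subseteq> V" "convex hull V \<inter> {x. a \<bullet> x = b} = convex hull S"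
    using face_of_convex_hull_subset finite_imp_compact[OF assms(1)] by metis
  then have "S \<subseteq> V \<inter> {x. a \<bullet> x = b}"
    using hull_subset[of S convex] by blast
  moreover have "convex hull (V \<inter> {x. a \<bullet> x = b}) \<subseteq> convex hull V \<inter> {x. a \<bullet> x = b}"
    by (intro hull_minimal) (auto simp: hull_inc convex_Int convex_hyperplane)
  ultimately show "convex hull V \<inter> {x. a \<bullet> x = b} = convex hull (V \<inter> {x. a \<bullet> x = b})"
    using S(2) hull_mono by blast
qed

text \<open>The face on which \<open>a\<close> is maximal has \<open>v\<close> as its only
  generator, so it is a single point.\<close>

lemma extreme_point_of_convex_hull_maximizer:
  fixes a :: "'a::euclidean_space"
  assumes "finite V" "v \<in> V" and "\<And>x. x \<in> V \<Longrightarrow> x \<noteq> v \<Longrightarrow> a \<bullet> x < a \<bullet> v"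
  shows "v extreme_point_of convex hull V"
proof -
  have le: "a \<bullet> x \<le> a \<bullet> v" if "x \<in> V" for x
    using assms(3) that less_eq_real_def by blast
  have "V \<inter> {x. a \<bullet> x = a \<bullet> v} = {v}"
    using assms(2,3) by force
  then have "convex hull V \<inter> {x. a \<bullet> x = a \<bullet> v} = {v}"
    using convex_hull_supporting_hyperplane(2)[OF assms(1) le] by simp
  moreover have "(convex hull V \<inter> {x. a \<bullet> x = a \<bullet> v}) face_of (convex hull V)"
    using convex_hull_supporting_hyperplane(1)[OF assms(1) le]
    by (intro face_of_Int_supporting_hyperplane_le) auto
  ultimately show ?thesis
    by (simp add: face_of_singleton)
qed

section \<open>Parallelograms as an obstruction\<close>

text \<open>The point \<open>z\<close> makes the face proper, so it lies in a facet, and the four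
  points are still extreme there. The coefficients 1, 1, -1, -1 form an affine dependence,
  impossible in a simplex, and an integer linear dependence, impossible in a lattice basis.\<close>

lemma parallelogram_in_proper_face:
  fixes K :: "(real ^ 'n) set"
  assumes "polytope K" and vs: "{v1, v2, v3, v4} \<subseteq> vertices K"
    and sum: "v1 + v2 = v3 + v4"
    and dist: "v1 \<noteq> v2" "v1 \<noteq> v3" "v1 \<noteq> v4" "v2 \<noteq> v3" "v2 \<noteq> v4" "v3 \<noteq> v4"
    and "K \<subseteq> {x. a \<bullet> x \<le> b}" and on: "{v1, v2, v3, v4} \<subseteq> {x. a \<bullet> x = b}"
    and "z \<in> K" "a \<bullet> z \<noteq> b"
  shows "\<not> simplicial_polytope K" and "\<not> smooth_fano K"
proof -
  have ext: "x extreme_point_of K" if "x \<in> {v1, v2, v3, v4}" for x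
    using vs that by (auto simp: vertices_def)
  have "(K \<inter> {x. a \<bullet> x = b}) face_of K"
    using assms by (intro face_of_Int_supporting_hyperplane_le polytope_imp_convex) auto
  moreover have "v1 \<in> K \<inter> {x. a \<bullet> x = b}"
    using ext[of v1] on by (auto simp: extreme_point_of_def)
  ultimately obtain F where F: "F facet_of K" "K \<inter> {x. a \<bullet> x = b} \<subseteq> F"
    using face_of_polyhedron_subset_facet[of K "K \<inter> {x. a \<bullet> x = b}"] assms
      polytope_imp_polyhedron by blast
  have extF: "{v1, v2, v3, v4} \<subseteq> {x. x extreme_point_of F}"
    using ext F on extreme_point_of_face[OF facet_of_imp_face_of[OF F(1)]]
    by (force simp: extreme_point_of_def)
  show "\<not> simplicial_polytope K"
  proof
    assume "simplicial_polytope K"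
    then obtain C where C: "\<not> affine_dependent C" "F = convex hull C"
      using F(1) unfolding simplicial_polytope_def simplex_def by blast
    then have sub: "{v1, v2, v3, v4} \<subseteq> C"
      using extF extreme_point_of_convex_hull_affine_independent by blast
    define U where "U = (\<lambda>x. if x = v1 \<or> x = v2 then 1 else -1 :: real)"
    have U: "sum U {v1, v2, v3, v4} = 0" "(\<Sum>v\<in>{v1, v2, v3, v4}. U v *\<^sub>R v) = 0"
      using dist sum by (auto simp: U_def algebra_simps)
    have "\<exists>v\<in>{v1, v2, v3, v4}. U v \<noteq> 0" by (simp add: U_def)
    then have "affine_dependent C"
      unfolding affine_dependent_explicit
      by (intro exI[of _ "{v1, v2, v3, v4}"] exI[of _ U] conjI sub U finite.intros)
    with C show False by simp
  qed
  show "\<not> smooth_fano K"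
  proof
    assume "smooth_fano K"
    then have ind: "int_module.independent (vertices F)"
      using F(1) by (simp add: smooth_fano_def int_basis_def)
    define U where "U = (\<lambda>x. if x = v1 \<or> x = v2 then 1 else -1 :: int)"
    have U: "(\<Sum>v\<in>{v1, v2, v3, v4}. of_int (U v) *\<^sub>R v) = 0"
      using dist sum by (simp add: U_def algebra_simps)
    have "\<exists>v\<in>{v1, v2, v3, v4}. U v \<noteq> 0" by (simp add: U_def)
    then have "int_module.dependent (vertices F)"
      unfolding int_module.dependent_explicit vertices_def
      by (intro exI[of _ "{v1, v2, v3, v4}"] exI[of _ U] conjI extF U finite.intros)
    with ind show False by simp
  qed
qed

section \<open>Vertices of the polytope and comparability of intersecting ideals\<close>

lemma signed_\<rho>_extreme_point:
  fixes A B :: "'n::finite set set" and s :: real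
  assumes s: "s = 1 \<or> s = -1" and "I \<in> A" "I \<noteq> {}"
  shows "s *\<^sub>R \<rho> I extreme_point_of
    convex hull ((\<lambda>I. s *\<^sub>R \<rho> I) ` A \<union> (\<lambda>J. - (s *\<^sub>R \<rho> J)) ` B)"
proof -
  \<comment> \<open>Among the indicator vectors this functional is largest only at \<open>I\<close>.
    On a negated indicator vector of \<open>J\<close> it is at most the size of
    \<open>J - I\<close>, which is below d since \<open>I\<close> is nonempty, whereas its value at
    \<open>I\<close> is at least d.\<close>
  define c :: "real ^ 'n" where "c = (\<chi> i. if i \<in> I then real CARD('n) else -1)"
  have ss: "(s *\<^sub>R c) \<bullet> (s *\<^sub>R x) = c \<bullet> x" for x
    using s by auto
  have card: "real CARD('n) > 0" by simp
  have less: "c \<bullet> \<rho> S < c \<bullet> \<rho> I" if "S \<noteq> I" for S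
  proof -
    have eq: "c \<bullet> \<rho> S = (\<Sum>i\<in>UNIV. if i \<in> S then c $ i else 0)" for S
      by (simp add: inner_\<rho> sum.If_cases)
    show ?thesis
      unfolding eq using that card
      by (intro sum_strict_mono_ex1) (auto simp: c_def set_eq_iff)
  qed
  have pos: "- (c \<bullet> \<rho> J) < c \<bullet> \<rho> I" for J
  proof -
    have "- (c \<bullet> \<rho> J) = (\<Sum>i\<in>J. - (c $ i))"
      by (simp add: inner_\<rho> sum_negf)
    also have "\<dots> \<le> (\<Sum>i\<in>J. if i \<in> I then 0 else 1)"
      by (intro sum_mono) (auto simp: c_def)
    also have "\<dots> = real (card (J - I))"
      by (simp add: sum.If_cases Diff_eq)
    also have "\<dots> < real CARD('n)"
      using \<open>I \<noteq> {}\<close> by (auto intro!: psubset_card_mono)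
    also have "\<dots> \<le> real (card I) * real CARD('n)"
      using \<open>I \<noteq> {}\<close> by (simp add: Suc_le_eq card_gt_0_iff)
    also have "\<dots> = c \<bullet> \<rho> I"
      by (simp add: inner_\<rho> c_def)
    finally show ?thesis .
  qed
  show ?thesis
  proof (rule extreme_point_of_convex_hull_maximizer[where a = "s *\<^sub>R c"])
    fix x assume "x \<in> (\<lambda>I. s *\<^sub>R \<rho> I) ` A \<union> (\<lambda>J. - (s *\<^sub>R \<rho> J)) ` B" "x \<noteq> s *\<^sub>R \<rho> I"
    then show "(s *\<^sub>R c) \<bullet> x < (s *\<^sub>R c) \<bullet> (s *\<^sub>R \<rho> I)"
      using less pos by (auto simp: ss inj_\<rho> simp del: inner_scaleR_left inner_scaleR_right)
  qed (use assms in auto)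
qed

text \<open>The four vertices \<open>\<rho> I\<close>, \<open>\<rho> I'\<close>, \<open>\<rho> (I \<union> I')\<close>, \<open>\<rho> (I \<inter> I')\<close> span a parallelogram in
  the face \<open>x\<^sub>m = 1\<close>, where \<open>m \<in> I \<inter> I'\<close>. The sign \<open>s\<close> serves both posets at once.\<close>

lemma signed_hull_laminar:
  fixes A B :: "'n::finite set set" and s :: real
  assumes s: "s = 1 \<or> s = -1"
    and K: "K = convex hull ((\<lambda>I. s *\<^sub>R \<rho> I) ` A \<union> (\<lambda>J. - (s *\<^sub>R \<rho> J)) ` B)"
    and "simplicial_polytope K \<or> smooth_fano K"
    and "I \<in> A" "I' \<in> A" "I \<union> I' \<in> A" "I \<inter> I' \<in> A" "{} \<in> A" "I \<inter> I' \<noteq> {}"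
  shows "I \<subseteq> I' \<or> I' \<subseteq> I"
proof (rule ccontr)
  assume inc: "\<not> (I \<subseteq> I' \<or> I' \<subseteq> I)"
  define V where "V = (\<lambda>I. s *\<^sub>R \<rho> I) ` A \<union> (\<lambda>J. - (s *\<^sub>R \<rho> J)) ` B"
  obtain m where m: "m \<in> I" "m \<in> I'" using assms by auto
  define a :: "real ^ 'n" where "a = s *\<^sub>R axis m 1"
  have a: "a \<bullet> (s *\<^sub>R \<rho> S) = of_bool (m \<in> S)" for S
    using s by (auto simp: a_def inner_axis' \<rho>_nth)
  have "finite V" by (simp add: V_def)
  have le: "a \<bullet> v \<le> 1" if "v \<in> V" for v
    using that by (auto simp: V_def a inner_minus_right simp del: inner_scaleR_right)
  have vert: "s *\<^sub>R \<rho> S \<in> vertices K" if "S \<in> A" "S \<noteq> {}" for S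
    using signed_\<rho>_extreme_point[OF s that] by (simp add: vertices_def K)
  have s0: "s \<noteq> 0" using s by auto
  let ?v = "\<lambda>S. s *\<^sub>R \<rho> S"
  have ne: "?v S \<noteq> ?v T" if "S \<noteq> T" for S T
    using s0 that by (simp add: inj_\<rho>)
  have 1: "polytope K" using \<open>finite V\<close> by (simp add: K V_def polytope_convex_hull)
  have 2: "{?v I, ?v I', ?v (I \<union> I'), ?v (I \<inter> I')} \<subseteq> vertices K"
    using vert assms by auto
  have 3: "?v I + ?v I' = ?v (I \<union> I') + ?v (I \<inter> I')"
    by (metis scaleR_add_right \<rho>_Un_Int)
  have 4: "K \<subseteq> {x. a \<bullet> x \<le> 1}"
    using convex_hull_supporting_hyperplane(1)[OF \<open>finite V\<close> le] by (simp add: K V_def)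
  have 5: "{?v I, ?v I', ?v (I \<union> I'), ?v (I \<inter> I')} \<subseteq> {x. a \<bullet> x = 1}"
    using m by (simp add: a del: inner_scaleR_right)
  \<comment> \<open>The empty ideal gives the origin, a point of the hull off the hyperplane, which
    shows that the face is proper.\<close>
  have 6: "?v {} \<in> K"
    unfolding K by (rule hull_inc) (use assms in blast)
  have 7: "a \<bullet> ?v {} \<noteq> 1" by simp
  have dist: "I \<noteq> I'" "I \<noteq> I \<union> I'" "I \<noteq> I \<inter> I'" "I' \<noteq> I \<union> I'" "I' \<noteq> I \<inter> I'" "I \<union> I' \<noteq> I \<inter> I'"
    using inc by auto
  note dist' = dist[THEN ne]
  show False
    using assms(3) parallelogram_in_proper_face[OF 1 2 3 dist' 4 5 6 7] by simp
qed

lemma \<Gamma>_laminar: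
  assumes "simplicial_polytope (\<Gamma> P Q) \<or> smooth_fano (\<Gamma> P Q)"
  shows "\<And>I I'. \<lbrakk>poset_ideal P I; poset_ideal P I'; I \<inter> I' \<noteq> {}\<rbrakk> \<Longrightarrow> I \<subseteq> I' \<or> I' \<subseteq> I"
    and "\<And>I I'. \<lbrakk>poset_ideal Q I; poset_ideal Q I'; I \<inter> I' \<noteq> {}\<rbrakk> \<Longrightarrow> I \<subseteq> I' \<or> I' \<subseteq> I"
proof -
  have P: "\<Gamma> P Q = convex hull ((\<lambda>I. 1 *\<^sub>R \<rho> I) ` Collect (poset_ideal P) \<union>
      (\<lambda>J. - (1 *\<^sub>R \<rho> J)) ` Collect (poset_ideal Q))"
    unfolding \<Gamma>_def by (rule arg_cong[where f = "(hull) convex"]) auto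
  \<comment> \<open>With \<open>s = -1\<close> the same polytope is presented with the two posets
    exchanged.\<close>
  have Q: "\<Gamma> P Q = convex hull ((\<lambda>I. (-1) *\<^sub>R \<rho> I) ` Collect (poset_ideal Q) \<union>
      (\<lambda>J. - ((-1) *\<^sub>R \<rho> J)) ` Collect (poset_ideal P))"
    unfolding \<Gamma>_def by (rule arg_cong[where f = "(hull) convex"]) auto
  have ideals: "poset_ideal R {}" "poset_ideal R I \<Longrightarrow> poset_ideal R I' \<Longrightarrow> poset_ideal R (I \<union> I')"
    "poset_ideal R I \<Longrightarrow> poset_ideal R I' \<Longrightarrow> poset_ideal R (I \<inter> I')" for R :: "'a rel" and I I'
    by (auto simp: poset_ideal_def)
  show "I \<subseteq> I' \<or> I' \<subseteq> I" if "poset_ideal P I" "poset_ideal P I'" "I \<inter> I' \<noteq> {}" for I I'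
    by (rule signed_hull_laminar[OF _ P assms]) (use that ideals in auto)
  show "I \<subseteq> I' \<or> I' \<subseteq> I" if "poset_ideal Q I" "poset_ideal Q I'" "I \<inter> I' \<noteq> {}" for I I'
    by (rule signed_hull_laminar[OF _ Q assms]) (use that ideals in auto)
qed

section \<open>Ideal families in which intersecting members are comparable\<close>

text \<open>Initial segments of a linear extension are ideals, so every ideal meeting one is
  comparable with it. An ideal containing \<open>j 1\<close> is compared with the segment that ends
  at its first missing index, any other ideal with the segment that ends at its first own
  index.\<close>

lemma laminar_ideals_classification:
  fixes P :: "'n::finite rel"
  assumes card: "CARD('n) \<ge> 2" and j: "index_permutation j"
    and ext: "\<And>a b. \<lbrakk>a \<in> {1..CARD('n)}; b \<in> {1..CARD('n)}; (j a, j b) \<in> P; j a \<noteq> j b\<rbrakk> \<Longrightarrow> a < b"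
    and lam: "\<And>I I'. \<lbrakk>poset_ideal P I; poset_ideal P I'; I \<inter> I' \<noteq> {}\<rbrakk> \<Longrightarrow> I \<subseteq> I' \<or> I' \<subseteq> I"
  shows "nonempty_ideals P = initial_segments j \<or> nonempty_ideals P = initial_segments' j"
proof -
  let ?D = "{1..CARD('n)}"
  have inj: "inj_on j ?D" and sur: "j ` ?D = UNIV"
    using j by (auto simp: index_permutation_def bij_betw_def)
  have seg: "poset_ideal P (j ` {1..k})" if "k \<in> ?D" for k
    unfolding poset_ideal_def
  proof (intro allI impI)
    fix x y assume x: "x \<in> j ` {1..k}" and yx: "(y, x) \<in> P"
    from x obtain b where b: "x = j b" "b \<in> {1..k}" by auto
    obtain a where a: "y = j a" "a \<in> ?D" using sur by blast
    show "y \<in> j ` {1..k}"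
    proof (cases "y = x")
      case False
      have "b \<in> ?D" using b(2) that by simp
      then have "a < b" using ext[of a b] a(2) yx False unfolding a(1) b(1) by blast
      then have "a \<in> {1..k}" using a(2) b(2) by simp
      then show ?thesis unfolding a(1) by (rule imageI)
    qed (use x in simp)
  qed
  have main: "I \<in> initial_segments j \<or> I = {j 2}" if I: "poset_ideal P I" "I \<noteq> {}" for I
  proof (cases "j 1 \<in> I")
    case True
    show ?thesis
    proof (cases "I = UNIV")
      case True
      then have "I = j ` {1..CARD('n)}" using sur by simp
      moreover have "CARD('n) \<in> ?D" using card by simp
      ultimately show ?thesis unfolding initial_segments_def by blast
    next
      case False
      then obtain x where "x \<notin> I" by auto
      moreover have "x \<in> j ` ?D" by (subst sur) simp
      ultimately have ex: "\<exists>l. l \<in> ?D \<and> j l \<notin> I" by auto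
      obtain l where l: "l \<in> ?D" "j l \<notin> I"
        and l': "\<And>k. k \<in> ?D \<Longrightarrow> k < l \<Longrightarrow> j k \<in> I"
        using ex exists_least_iff[of "\<lambda>l. l \<in> ?D \<and> j l \<notin> I"] by blast
      \<comment> \<open>This makes \<open>l - 1\<close> at least 1, so that the segment ending there
        belongs to the family.\<close>
      have "l \<noteq> 1" using l True by auto
      have "j 1 \<in> j ` {1..l}" using l(1) by simp
      then have "j ` {1..l} \<inter> I \<noteq> {}" using True by blast
      then have "j ` {1..l} \<subseteq> I \<or> I \<subseteq> j ` {1..l}" using lam seg l I by blast
      moreover have "j l \<in> j ` {1..l}" using l by auto
      ultimately have sub: "I \<subseteq> j ` {1..l}" using l(2) by blast
      have "I = j ` {1..l - 1}"
      proof
        show "I \<subseteq> j ` {1..l - 1}"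
        proof
          fix x assume "x \<in> I"
          then obtain k where k: "x = j k" "k \<in> {1..l}" using sub by auto
          then have "k \<noteq> l" using \<open>x \<in> I\<close> l by auto
          then show "x \<in> j ` {1..l - 1}" using k by auto
        qed
        show "j ` {1..l - 1} \<subseteq> I" using l' l by auto
      qed
      moreover have "l - 1 \<in> ?D" using l \<open>l \<noteq> 1\<close> by auto
      ultimately show ?thesis unfolding initial_segments_def by blast
    qed
  next
    case False
    obtain x where "x \<in> I" using I by auto
    moreover have "x \<in> j ` ?D" by (subst sur) simp
    ultimately have ex: "\<exists>m. m \<in> ?D \<and> j m \<in> I" by auto
    obtain m where m: "m \<in> ?D" "j m \<in> I"
      and m': "\<And>k. k \<in> ?D \<Longrightarrow> k < m \<Longrightarrow> j k \<notin> I"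
      using ex exists_least_iff[of "\<lambda>m. m \<in> ?D \<and> j m \<in> I"] by blast
    have "j m \<in> j ` {1..m}" using m(1) by simp
    then have "j ` {1..m} \<inter> I \<noteq> {}" using m(2) by blast
    then have "j ` {1..m} \<subseteq> I \<or> I \<subseteq> j ` {1..m}" using lam seg m I by blast
    moreover have "j 1 \<in> j ` {1..m}" using m by auto
    ultimately have sub: "I \<subseteq> j ` {1..m}" using False by blast
    have eq: "I = {j m}"
    proof
      show "I \<subseteq> {j m}"
      proof
        fix x assume "x \<in> I"
        then obtain k where k: "x = j k" "k \<in> {1..m}" using sub by auto
        then have "\<not> k < m" using \<open>x \<in> I\<close> m m' by auto
        then show "x \<in> {j m}" using k by auto
      qed
    qed (use m in auto)
    have "m \<noteq> 1" using False m by auto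
    \<comment> \<open>For \<open>m > 2\<close> the ideals \<open>{j 1, j m}\<close> and
      \<open>{j 1, j 2}\<close> would share \<open>j 1\<close> without being comparable.\<close>
    moreover have "\<not> m > 2"
    proof
      assume "m > 2"
      have s1: "j ` {1..1} = {j 1}" and s2: "j ` {1..2} = {j 1, j 2}"
        by (auto simp: numeral_2_eq_2 atLeastAtMostSuc_conv)
      have p1: "poset_ideal P ({j 1} \<union> I)"
        using seg[of 1] I card unfolding s1 by (auto simp: poset_ideal_def)
      have p2: "poset_ideal P {j 1, j 2}" using seg[of 2] card unfolding s2 by auto
      have "j 2 \<noteq> j 1" "j 2 \<noteq> j m" "j 1 \<noteq> j m"
        using inj_on_eq_iff[OF inj] card m(1) \<open>m > 2\<close> by auto
      then show False using lam[OF p1 p2] eq by auto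
    qed
    ultimately have "m = 2" using m by auto
    then show ?thesis using eq by simp
  qed
  \<comment> \<open>The ideals are squeezed between two families that differ by at most one
    set.\<close>
  have sub: "initial_segments j \<subseteq> nonempty_ideals P"
    using seg by (auto simp: initial_segments_def nonempty_ideals_def)
  have "nonempty_ideals P \<subseteq> insert {j 2} (initial_segments j)"
    using main by (auto simp: nonempty_ideals_def)
  with sub show ?thesis unfolding initial_segments'_def by blast
qed

section \<open>Lattice bases and their dual bases\<close>

text \<open>An integral family with an integral dual family: \<open>u\<close> is a \<open>\<int>\<close>-basis of the lattice.\<close>

definition unimodular_pair :: "('n::finite \<Rightarrow> real ^ 'n) \<Rightarrow> ('n \<Rightarrow> real ^ 'n) \<Rightarrow> bool" where
  "unimodular_pair u w \<longleftrightarrow> (\<forall>k l. w k \<bullet> u l = of_bool (k = l)) \<and>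
     range u \<subseteq> int_lattice \<and> range w \<subseteq> int_lattice"

text \<open>Duality says that the square matrix with rows \<open>w k\<close> is a left inverse of
  the one with columns \<open>u k\<close>. It is then also a right inverse, which is the
  expansion.\<close>

lemma unimodular_pair_expansion:
  fixes u w :: "'n::finite \<Rightarrow> real ^ 'n"
  assumes "unimodular_pair u w"
  shows "x = (\<Sum>k\<in>UNIV. (w k \<bullet> x) *\<^sub>R u k)"
proof -
  define W :: "real ^ 'n ^ 'n" where "W = (\<chi> k. w k)"
  define U :: "real ^ 'n ^ 'n" where "U = (\<chi> m k. u k $ m)"
  have "W ** U = mat 1"
    using assms by (auto simp: unimodular_pair_def vec_eq_iff matrix_matrix_mult_def mat_def
        W_def U_def inner_vec_def)
  then have "U ** W = mat 1"
    using matrix_left_right_inverse by blast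
  then have "x = U *v (W *v x)"
    by (simp add: matrix_vector_mul_assoc)
  also have "\<dots> = (\<Sum>k\<in>UNIV. (w k \<bullet> x) *\<^sub>R u k)"
    by (simp add: vec_eq_iff matrix_vector_mult_def U_def W_def sum_component inner_vec_def mult.commute)
  finally show ?thesis .
qed

lemma unimodular_pair_eq_0:
  assumes "unimodular_pair u w" "\<And>k. a \<bullet> u k = 0"
  shows "a = 0"
proof -
  have "a \<bullet> a = a \<bullet> (\<Sum>k\<in>UNIV. (w k \<bullet> a) *\<^sub>R u k)"
    using unimodular_pair_expansion[OF assms(1), of a] by simp
  also have "\<dots> = 0" using assms(2) by (simp add: inner_sum_right)
  finally show ?thesis by simp
qed

lemma unimodular_pair_span:
  assumes "unimodular_pair u w"
  shows "span (range u) = UNIV"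
proof -
  have "x \<in> span (range u)" for x
    by (subst unimodular_pair_expansion[OF assms, of x])
      (intro span_sum span_scale span_base rangeI)
  then show ?thesis by blast
qed

lemma inner_int_lattice: "x \<in> int_lattice \<Longrightarrow> y \<in> int_lattice \<Longrightarrow> x \<bullet> y \<in> \<int>"
  by (auto simp: int_lattice_def inner_vec_def intro!: Ints_sum Ints_mult)

lemma subspace_int_lattice: "int_module.subspace int_lattice"
  by (auto simp: int_module.subspace_def int_lattice_def)

text \<open>The coordinates \<open>w k \<bullet> x\<close> of a lattice vector are integers because
  the dual family is integral too.\<close>

lemma int_span_eq_lattice:
  assumes "unimodular_pair u w" "T \<subseteq> int_lattice" "range u \<subseteq> int_module.span T"
  shows "int_module.span T = int_lattice"
proof
  show "int_module.span T \<subseteq> int_lattice"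
    by (rule int_module.span_minimal[OF assms(2) subspace_int_lattice])
  show "int_lattice \<subseteq> int_module.span T"
  proof
    fix x :: "real ^ 'a" assume x: "x \<in> int_lattice"
    have "(w k \<bullet> x) *\<^sub>R u k \<in> int_module.span T" for k
    proof -
      have "w k \<bullet> x \<in> \<int>"
        using assms(1) x by (intro inner_int_lattice) (auto simp: unimodular_pair_def)
      then obtain n where "w k \<bullet> x = of_int n" by (auto elim: Ints_cases)
      then show ?thesis
        using assms(3) by (auto intro: int_module.span_scale)
    qed
    then have "(\<Sum>k\<in>UNIV. (w k \<bullet> x) *\<^sub>R u k) \<in> int_module.span T"
      by (intro int_module.span_sum)
    then show "x \<in> int_module.span T"
      using unimodular_pair_expansion[OF assms(1), of x] by simp
  qed
qed

lemma independent_imp_int_independent: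
  assumes "independent B"
  shows "int_module.independent B"
proof
  assume "int_module.dependent B"
  then obtain t and c :: "_ \<Rightarrow> int" where "finite t" "t \<subseteq> B" "(\<Sum>v\<in>t. of_int (c v) *\<^sub>R v) = 0"
    "\<exists>v\<in>t. c v \<noteq> 0"
    unfolding int_module.dependent_explicit by blast
  then have "dependent B"
    unfolding dependent_explicit by (intro exI[of _ t] exI[of _ "\<lambda>v. of_int (c v)"]) auto
  with assms show False by simp
qed

text \<open>If neither \<open>u k\<close> nor \<open>- u k\<close> were in \<open>T\<close>, then
  \<open>w k\<close> would vanish on the span of \<open>T\<close>; both cannot be, as
  \<open>b \<noteq> 0\<close>. So \<open>T\<close> takes one sign for each index. At most d spanning
  vectors are independent, and up to sign they are all of \<open>range u\<close>.\<close>

lemma spanning_signed_basis: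
  fixes u w :: "'n::finite \<Rightarrow> real ^ 'n"
  assumes uw: "unimodular_pair u w" and T: "T \<subseteq> range u \<union> uminus ` range u"
    and ab: "T \<subseteq> {x. a \<bullet> x = b}" "b \<noteq> 0" and span: "span T = UNIV"
  shows "independent T" and "int_basis T"
proof -
  have uT: "u k \<in> T \<or> - u k \<in> T" for k
  proof (rule ccontr)
    assume "\<not> ?thesis"
    have "orthogonal (w k) x" if x: "x \<in> T" for x
    proof -
      obtain l where l: "x = u l \<or> x = - u l" using subsetD[OF T x] by auto
      then have "l \<noteq> k" using \<open>\<not> (u k \<in> T \<or> - u k \<in> T)\<close> x by auto
      then show ?thesis using l uw by (auto simp: orthogonal_def unimodular_pair_def)
    qed
    then have "orthogonal (w k) (u k)"
      using orthogonal_to_span[of "u k" T "w k"] span by auto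
    then show False using uw by (simp add: orthogonal_def unimodular_pair_def)
  qed
  define s where "s = (\<lambda>k. if u k \<in> T then u k else - u k)"
  have "T \<subseteq> range s"
  proof
    fix x assume x: "x \<in> T"
    then obtain k where k: "x = u k \<or> x = - u k" using subsetD[OF T x] by auto
    have "\<not> (u k \<in> T \<and> - u k \<in> T)"
    proof
      assume "u k \<in> T \<and> - u k \<in> T"
      then have "a \<bullet> u k = b" "a \<bullet> (- u k) = b" using ab(1) by blast+
      then show False using ab(2) by simp
    qed
    then have "x = s k" using k x by (auto simp: s_def)
    then show "x \<in> range s" by blast
  qed
  then have fin: "finite T" and card: "card T \<le> CARD('n)"
    by (auto intro: finite_subset surj_card_le[of UNIV])
  show ind: "independent T"
    using card_le_dim_spanning[of T UNIV] span fin card by auto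
  have "T \<subseteq> int_lattice"
  proof
    fix x assume "x \<in> T"
    then obtain k where "x = u k \<or> x = - u k" using subsetD[OF T] by blast
    moreover have "u k \<in> int_lattice" using uw by (auto simp: unimodular_pair_def)
    ultimately show "x \<in> int_lattice" by (auto simp: int_lattice_def)
  qed
  moreover have "range u \<subseteq> int_module.span T"
  proof
    fix x assume "x \<in> range u"
    then obtain k where "x = u k" by auto
    then have "x \<in> T \<or> - x \<in> T" using uT by simp
    then show "x \<in> int_module.span T"
      using int_module.span_base int_module.span_neg by fastforce
  qed
  ultimately show "int_basis T"
    using int_span_eq_lattice[OF uw] independent_imp_int_independent[OF ind]
    by (simp add: int_basis_def)
qed

text \<open>An elementary change of basis that makes the difference a basis vector. Adding
  \<open>w q\<close> to \<open>w p\<close> makes the new dual vector vanish on it.\<close>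

lemma unimodular_pair_shear:
  assumes uw: "unimodular_pair u w" and pq: "p \<noteq> q"
  shows "unimodular_pair (u(q := u q - u p)) (w(p := w p + w q))"
proof -
  have "w k \<bullet> u l = of_bool (k = l)" for k l
    using uw by (simp add: unimodular_pair_def)
  then have "(w(p := w p + w q)) k \<bullet> (u(q := u q - u p)) l = of_bool (k = l)" for k l
    using pq by (auto simp: inner_diff_right inner_add_left)
  moreover have "u k \<in> int_lattice" "w k \<in> int_lattice" for k
    using uw by (auto simp: unimodular_pair_def)
  then have "u q - u p \<in> int_lattice" "w p + w q \<in> int_lattice"
    by (auto simp: int_lattice_def)
  ultimately show ?thesis
    using uw by (auto simp: unimodular_pair_def)
qed

section \<open>Hulls of a signed lattice basis with optional differences\<close>

text \<open>The two inclusions leave open which of the two differences are generators, so one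
  argument covers all four combinations of ideal families.\<close>

context
  fixes u w :: "'n::finite \<Rightarrow> real ^ 'n" and p q :: 'n and V :: "(real ^ 'n) set"
  assumes uw: "unimodular_pair u w" and pq: "p \<noteq> q"
    and lower: "insert 0 (range u \<union> uminus ` range u) \<subseteq> V"
    and upper: "V \<subseteq> insert 0 (range u \<union> uminus ` range u) \<union> {u q - u p, u p - u q}"
begin

lemma hull_finite: "finite V"
  using upper by (rule finite_subset) auto

text \<open>Every generator, including the differences, has all its coordinates in {-1, 0,
  1}.\<close>

lemma hull_dual_le: "x \<in> convex hull V \<Longrightarrow> \<bar>w k \<bullet> x\<bar> \<le> 1"
proof -
  have "\<bar>w k \<bullet> v\<bar> \<le> 1" if "v \<in> V" for v
    using upper uw that pq by (auto simp: unimodular_pair_def inner_diff_right)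
  then have "V \<subseteq> {x. w k \<bullet> x \<le> 1} \<inter> {x. w k \<bullet> x \<ge> -1}"
    by force
  then have "convex hull V \<subseteq> {x. w k \<bullet> x \<le> 1} \<inter> {x. w k \<bullet> x \<ge> -1}"
    by (intro hull_minimal convex_Int convex_halfspace_le convex_halfspace_ge)
  then show "\<bar>w k \<bullet> x\<bar> \<le> 1" if "x \<in> convex hull V"
    using that by force
qed

lemma hull_full_dim: "aff_dim (convex hull V) = int CARD('n)"
proof -
  have "range u \<subseteq> V" "0 \<in> V" using lower by auto
  then have "span V = UNIV"
    using unimodular_pair_span[OF uw] span_mono[of "range u" V] by auto
  then have "dim V = CARD('n)"
    by (metis dim_span dim_UNIV DIM_cart DIM_real mult.right_neutral)
  then show ?thesis
    using aff_dim_zero[of V] \<open>0 \<in> V\<close> by (simp add: aff_dim_convex_hull hull_inc)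
qed

text \<open>Otherwise a nonzero functional is nonnegative on the interior, hence on its closure and
  on all generators. These include both signs of each \<open>u k\<close>, so the functional vanishes
  on a basis.\<close>

lemma hull_interior_0: "0 \<in> interior (convex hull V)"
proof (rule ccontr)
  let ?K = "convex hull V"
  assume "0 \<notin> interior ?K"
  moreover have "interior ?K \<noteq> {}"
  proof -
    have "affine hull ?K = UNIV"
      using hull_full_dim aff_dim_eq_full[of ?K] by simp
    then have "interior ?K = rel_interior ?K"
      by (simp add: rel_interior_interior)
    then show ?thesis
      using lower by (auto simp: rel_interior_eq_empty)
  qed
  ultimately obtain a where a: "a \<noteq> 0" "\<And>x. x \<in> interior ?K \<Longrightarrow> a \<bullet> x \<ge> 0"
    using separating_hyperplane_set_0[of "interior ?K"] convex_interior convex_convex_hull by metis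
  have "?K \<subseteq> closure (interior ?K)"
    using convex_closure_interior[of ?K] \<open>interior ?K \<noteq> {}\<close> closure_subset by auto
  also have "\<dots> \<subseteq> {x. a \<bullet> x \<ge> 0}"
    using a by (intro closure_minimal closed_halfspace_ge) auto
  finally have "a \<bullet> v \<ge> 0" if "v \<in> V" for v
    using that hull_inc by force
  then have "a \<bullet> u k \<ge> 0" "a \<bullet> (- u k) \<ge> 0" for k
    using lower by blast+
  then have "a \<bullet> u k = 0" for k
    by (smt (verit) inner_minus_right)
  then show False using unimodular_pair_eq_0[OF uw] a by blast
qed

lemma hull_fano: "fano_polytope (convex hull V)"
proof -
  let ?K = "convex hull V"
  have "V \<subseteq> int_lattice"
  proof -
    have "u k \<in> int_lattice" for k using uw by (auto simp: unimodular_pair_def)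
    then have "insert 0 (range u \<union> uminus ` range u) \<union> {u q - u p, u p - u q} \<subseteq> int_lattice"
      by (auto simp: int_lattice_def)
    with upper show ?thesis by blast
  qed
  moreover have "vertices ?K \<subseteq> V"
    using extreme_point_of_convex_hull by (auto simp: vertices_def)
  moreover have "x = 0" if x: "x \<in> interior ?K" "x \<in> int_lattice" for x
  proof -
    obtain e where e: "e > 0" "ball x e \<subseteq> ?K"
      using x(1) by (auto simp: mem_interior)
    \<comment> \<open>Since a point slightly beyond \<open>x\<close> is still in the hull, the bound
      1 on the coordinates becomes strict at \<open>x\<close>, and integers of absolute value below
      1 are 0.\<close>
    obtain r where r: "r > 0" "(1 + r) *\<^sub>R x \<in> ?K"
    proof
      \<comment> \<open>The added 1 keeps the denominator positive when
        \<open>x = 0\<close>.\<close>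
      define r where "r = e / (2 * (norm x + 1))"
      have "norm x + 1 > 0" by (smt (verit) norm_ge_zero)
      then show "e / (2 * (norm x + 1)) > 0" using e by simp
      have "r * norm x < e"
        using e \<open>norm x + 1 > 0\<close> unfolding r_def
        by (simp add: field_simps) (smt (verit) mult_nonneg_nonneg norm_ge_zero)
      moreover have "r > 0" using \<open>e / (2 * (norm x + 1)) > 0\<close> by (simp add: r_def)
      ultimately have "(1 + r) *\<^sub>R x \<in> ball x e"
        by (simp add: dist_norm scaleR_add_left)
      then show "(1 + e / (2 * (norm x + 1))) *\<^sub>R x \<in> ?K" using e r_def by blast
    qed
    have "w k \<bullet> x = 0" for k
    proof -
      have "w k \<bullet> x \<in> \<int>"
        using uw x by (intro inner_int_lattice) (auto simp: unimodular_pair_def)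
      moreover have "(1 + r) * \<bar>w k \<bullet> x\<bar> \<le> 1"
        using hull_dual_le[OF r(2), of k] r(1) by (simp add: abs_mult)
      then have "\<bar>w k \<bullet> x\<bar> < 1"
        using r(1) by (smt (verit) mult_less_cancel_right1)
      ultimately show ?thesis
        using Ints_nonzero_abs_less1 by blast
    qed
    then show "x = 0"
      using unimodular_pair_expansion[OF uw, of x] by simp
  qed
  moreover have "0 \<in> int_lattice" by (simp add: int_lattice_def)
  ultimately show ?thesis
    using hull_full_dim hull_interior_0 hull_finite
    by (auto simp: fano_polytope_def polytope_convex_hull)
qed

lemma hull_facet:
  assumes F: "F facet_of convex hull V"
  obtains T where "F = convex hull T" "independent T" "int_basis T"
proof -
  let ?K = "convex hull V"
  have "polyhedron ?K"
    using hull_finite by (simp add: polytope_imp_polyhedron polytope_convex_hull)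
  then have "F exposed_face_of ?K"
    using F exposed_face_of_polyhedron facet_of_imp_face_of by blast
  then obtain a b where ab: "?K \<subseteq> {x. a \<bullet> x \<le> b}" "F = ?K \<inter> {x. a \<bullet> x = b}"
    unfolding exposed_face_of_def by blast
  define T where "T = V \<inter> {x. a \<bullet> x = b}"
  have le: "a \<bullet> v \<le> b" if "v \<in> V" for v
    using ab(1) that hull_inc by force
  have FT: "F = convex hull T"
    using convex_hull_supporting_hyperplane(2)[OF hull_finite le] ab T_def by simp
  have dimF: "aff_dim F = int CARD('n) - 1"
    using F hull_full_dim by (simp add: facet_of_def)
  \<comment> \<open>A hyperplane through the origin would bound both signs of each
    \<open>u k\<close> by 0, forcing \<open>a = 0\<close> and the facet to be the whole
    polytope.\<close>
  have b: "b \<noteq> 0"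
  proof
    assume "b = 0"
    have "a \<bullet> u k \<le> 0" "a \<bullet> (- u k) \<le> 0" for k
      using le lower \<open>b = 0\<close> by blast+
    then have "a \<bullet> u k = 0" for k
      by (smt (verit) inner_minus_right)
    then have "a = 0" using unimodular_pair_eq_0[OF uw] by blast
    then have "F = ?K" using ab \<open>b = 0\<close> by simp
    then show False using dimF hull_full_dim by simp
  qed
  \<comment> \<open>The hyperplane misses the origin, so adjoining 0 raises the affine dimension d -
    1 of \<open>T\<close> to d.\<close>
  have span: "span T = UNIV"
  proof -
    have "affine hull T \<subseteq> {x. a \<bullet> x = b}"
      by (intro hull_minimal affine_hyperplane) (auto simp: T_def)
    then have "0 \<notin> affine hull T" using b by auto
    then have "aff_dim (insert 0 T) = int CARD('n)"
      using dimF by (simp add: aff_dim_insert FT aff_dim_convex_hull)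
    then have "dim T = CARD('n)"
      using aff_dim_zero[of "insert 0 T"]
      by (metis dim_span span_insert_0 hull_inc insertI1 of_nat_eq_iff)
    then show ?thesis using dim_eq_full[of T] by simp
  qed
  have Tab: "T \<subseteq> {x. a \<bullet> x = b}" by (auto simp: T_def)
  have Tup: "x \<in> range u \<union> uminus ` range u \<or> x = u q - u p \<or> x = u p - u q" if "x \<in> T" for x
    using that upper b by (auto simp: T_def)
  \<comment> \<open>The first case keeps the basis \<open>u\<close>; the second replaces
    \<open>u q\<close>, and the third \<open>u p\<close>, by the difference.\<close>
  consider "u q - u p \<notin> T \<and> u p - u q \<notin> T" | "u q \<notin> T \<and> - u q \<notin> T" | "u p \<notin> T \<and> - u p \<notin> T"
  proof -
    have T: "a \<bullet> x = b" if "x \<in> T" for x using that by (simp add: T_def)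
    have "\<not> ((u q - u p \<in> T \<or> u p - u q \<in> T) \<and> (u q \<in> T \<or> - u q \<in> T) \<and> (u p \<in> T \<or> - u p \<in> T))"
      using b T[of "u q - u p"] T[of "u p - u q"] T[of "u q"] T[of "- u q"] T[of "u p"] T[of "- u p"]
      by (smt (verit) inner_diff_right inner_minus_right)
    then show ?thesis using that by blast
  qed
  then have "independent T \<and> int_basis T"
  proof cases
    case 1
    then have "T \<subseteq> range u \<union> uminus ` range u" using Tup by blast
    then show ?thesis using spanning_signed_basis[OF uw _ Tab b span] by blast
  next
    case 2
    let ?u = "u(q := u q - u p)"
    have "x \<in> range ?u \<union> uminus ` range ?u" if x: "x \<in> T" for x
    proof -
      consider k where "x = u k" | k where "x = - u k" | "x = u q - u p" | "x = - (u q - u p)"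
        using Tup[OF x] by auto
      then have "\<exists>k. x = ?u k \<or> x = - ?u k"
        using 2 x by cases (metis fun_upd_apply)+
      then show ?thesis by blast
    qed
    then show ?thesis
      using spanning_signed_basis[OF unimodular_pair_shear[OF uw pq] _ Tab b span] by blast
  next
    case 3
    let ?u = "u(p := u p - u q)"
    have "x \<in> range ?u \<union> uminus ` range ?u" if x: "x \<in> T" for x
    proof -
      consider k where "x = u k" | k where "x = - u k" | "x = u p - u q" | "x = - (u p - u q)"
        using Tup[OF x] by auto
      then have "\<exists>k. x = ?u k \<or> x = - ?u k"
        using 3 x by cases (metis fun_upd_apply)+
      then show ?thesis by blast
    qed
    then show ?thesis
      using spanning_signed_basis[OF unimodular_pair_shear[OF uw pq[symmetric]] _ Tab b span] by blast
  qed
  then show ?thesis using that FT by blast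
qed

lemma hull_Q_factorial: "Q_factorial_fano (convex hull V)"
proof -
  have "\<exists>k. k simplex F" if F: "F facet_of convex hull V" for F
  proof -
    obtain T where T: "F = convex hull T" "independent T"
      using hull_facet[OF F] by blast
    then have "(int (card T) - 1) simplex F"
      using affine_dependent_imp_dependent by (auto simp: simplex_def)
    then show ?thesis by blast
  qed
  then show ?thesis
    using hull_fano hull_finite
    by (auto simp: Q_factorial_fano_def simplicial_polytope_def polytope_convex_hull)
qed

text \<open>An affinely independent \<open>T\<close> consists exactly of the extreme points of its
  hull, so the basis property of \<open>T\<close> passes to the vertices of the facet.\<close>

lemma hull_smooth: "smooth_fano (convex hull V)"
proof -
  have "int_basis (vertices F)" if F: "F facet_of convex hull V" for F
  proof -
    obtain T where T: "F = convex hull T" "independent T" "int_basis T"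
      using hull_facet[OF F] by blast
    have "\<not> affine_dependent T"
      using T(2) affine_dependent_imp_dependent by blast
    then have "vertices F = T"
      using extreme_point_of_convex_hull_affine_independent[of T] by (simp add: vertices_def T(1))
    with T show ?thesis by simp
  qed
  then show ?thesis using hull_fano by (simp add: smooth_fano_def)
qed

end

section \<open>The basis attached to a chain of initial segments\<close>

lemma \<Gamma>_initial_segments:
  fixes P Q :: "'n::finite rel"
  assumes card: "CARD('n) \<ge> 2" and i: "index_permutation i"
    and P: "nonempty_ideals P = initial_segments i \<or> nonempty_ideals P = initial_segments' i"
    and Q: "nonempty_ideals Q = initial_segments i \<or> nonempty_ideals Q = initial_segments' i"
  shows "Q_factorial_fano (\<Gamma> P Q)" and "smooth_fano (\<Gamma> P Q)"
proof -
  let ?d = "CARD('n)"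
  have inj: "inj_on i {1..?d}" and sur: "i ` {1..?d} = UNIV"
    using i by (auto simp: index_permutation_def bij_betw_def)
  \<comment> \<open>The inverse of \<open>i\<close> lets the segments be indexed by
    \<open>'n\<close> itself, as the basis must be.\<close>
  define pos where "pos = inv_into {1..?d} i"
  have pos: "pos x \<in> {1..?d}" "i (pos x) = x" for x
    using inv_into_into[of x i "{1..?d}"] f_inv_into_f[of x i "{1..?d}"]
    unfolding pos_def sur by blast+
  have pos_i: "pos (i k) = k" if "k \<in> {1..?d}" for k
    using inj that by (simp add: pos_def)
  have pos_inj: "pos x = pos y \<longleftrightarrow> x = y" for x y
    using pos by metis
  define u :: "'n \<Rightarrow> real ^ 'n" where "u = (\<lambda>x. \<rho> (i ` {1..pos x}))"
  \<comment> \<open>The dual basis takes differences of consecutive coordinates; the last index has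
    no successor, so nothing is subtracted there.\<close>
  define w :: "'n \<Rightarrow> real ^ 'n" where
    "w = (\<lambda>x. axis x 1 - (if pos x < ?d then axis (i (pos x + 1)) 1 else 0))"
  have mem: "x \<in> i ` {1..pos y} \<longleftrightarrow> pos x \<le> pos y" for x y
  proof
    assume "x \<in> i ` {1..pos y}"
    then obtain k where k: "x = i k" "k \<in> {1..pos y}" by auto
    then have "k \<in> {1..?d}" using pos(1)[of y] by auto
    then show "pos x \<le> pos y" using k pos_i by auto
  next
    assume "pos x \<le> pos y"
    then have "pos x \<in> {1..pos y}" using pos(1)[of x] by auto
    then show "x \<in> i ` {1..pos y}" using pos(2)[of x] by (metis imageI)
  qed
  have uw: "unimodular_pair u w"
  proof -
    have "w x \<bullet> u y = of_bool (x = y)" for x y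
    proof (cases "pos x < ?d")
      case True
      then have "w x \<bullet> u y = of_bool (pos x \<le> pos y) - of_bool (pos x + 1 \<le> pos y)"
        using pos_i[of "pos x + 1"] by (simp add: w_def u_def inner_diff_left inner_axis' \<rho>_nth mem del: One_nat_def)
      then show ?thesis using pos_inj[of x y] by auto
    next
      case False
      then have "w x \<bullet> u y = of_bool (pos x \<le> pos y)"
        by (simp add: w_def u_def inner_axis' \<rho>_nth mem del: One_nat_def)
      moreover have "?d \<le> pos x" "pos x \<le> ?d" "pos y \<le> ?d"
        using False pos(1) by (simp_all add: not_less)
      then have "pos x \<le> pos y \<longleftrightarrow> pos x = pos y" by linarith
      ultimately show ?thesis unfolding pos_inj by simp
    qed
    then show ?thesis
      by (auto simp: unimodular_pair_def int_lattice_def u_def \<rho>_nth w_def axis_def)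
  qed
  have dom: "1 \<in> {1..?d}" "2 \<in> {1..?d}" using card by auto
  then have ne: "i 1 \<noteq> i 2" using inj_on_eq_iff[OF inj] by simp
  \<comment> \<open>The only ideal allowed besides the segments is thus the difference of the first
    two basis vectors, which fixes \<open>p = i 1\<close> and \<open>q = i 2\<close>.\<close>
  have u12: "u (i 2) - u (i 1) = \<rho> {i 2}"
  proof -
    have "i ` {1..2} = {i 1, i 2}" by (auto simp: numeral_2_eq_2 atLeastAtMostSuc_conv)
    then show ?thesis using ne dom by (simp add: u_def pos_i \<rho>_def)
  qed
  have seg: "\<rho> ` initial_segments i = range u"
  proof -
    have "initial_segments i = (\<lambda>k. i ` {1..k}) ` {1..?d}"
      by (auto simp: initial_segments_def)
    also have "{1..?d} = range pos"
    proof
      show "{1..?d} \<subseteq> range pos" using pos_i by (metis rangeI subsetI)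
      show "range pos \<subseteq> {1..?d}" using pos(1) by blast
    qed
    finally show ?thesis by (simp add: image_image u_def)
  qed
  have ideals: "{\<rho> I |I. poset_ideal R I} = insert 0 (\<rho> ` nonempty_ideals R)" for R :: "'n rel"
  proof -
    have "Collect (poset_ideal R) = insert {} (nonempty_ideals R)"
      by (auto simp: nonempty_ideals_def poset_ideal_def)
    moreover have "{\<rho> I |I. poset_ideal R I} = \<rho> ` Collect (poset_ideal R)" by auto
    ultimately show ?thesis by simp
  qed
  \<comment> \<open>Both admissible families satisfy these inclusions; the generator 0 comes from
    the empty ideal.\<close>
  have VR: "insert 0 (range u) \<subseteq> {\<rho> I |I. poset_ideal R I} \<and>
      {\<rho> I |I. poset_ideal R I} \<subseteq> insert 0 (range u) \<union> {u (i 2) - u (i 1)}"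
    if "nonempty_ideals R = initial_segments i \<or> nonempty_ideals R = initial_segments' i" for R :: "'n rel"
    using that unfolding ideals u12 seg[symmetric] initial_segments'_def by auto
  define A where "A = {\<rho> I |I. poset_ideal P I}"
  define B where "B = {\<rho> J |J. poset_ideal Q J}"
  note A = VR[OF P, folded A_def] and B = VR[OF Q, folded B_def]
  have B': "uminus ` range u \<subseteq> uminus ` B"
    "uminus ` B \<subseteq> uminus ` (insert 0 (range u) \<union> {u (i 2) - u (i 1)})"
    using B by (intro image_mono; simp)+
  have lower: "insert 0 (range u \<union> uminus ` range u) \<subseteq> A \<union> uminus ` B"
    using A B'(1) by (simp add: le_supI1 le_supI2)
  have B'': "uminus ` B \<subseteq> insert 0 (uminus ` range u) \<union> {u (i 1) - u (i 2)}"
    using B'(2) by (simp only: image_Un image_insert image_empty minus_diff_eq minus_zero)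
  have upper: "A \<union> uminus ` B \<subseteq> insert 0 (range u \<union> uminus ` range u) \<union>
      {u (i 2) - u (i 1), u (i 1) - u (i 2)}"
  proof (intro Un_least subsetI, goal_cases)
    case (1 x)
    then show ?case using subsetD[OF conjunct2[OF A] 1] by blast
  next
    case (2 x)
    then show ?case using subsetD[OF B'' 2] by blast
  qed
  have "{- \<rho> J |J. poset_ideal Q J} = uminus ` B" by (auto simp: B_def)
  then have "\<Gamma> P Q = convex hull (A \<union> uminus ` B)" by (simp add: \<Gamma>_def A_def)
  then show "Q_factorial_fano (\<Gamma> P Q)" "smooth_fano (\<Gamma> P Q)"
    using hull_Q_factorial[OF uw ne lower upper] hull_smooth[OF uw ne lower upper] by simp_all
qed

section \<open>Equivalence of the three conditions\<close>

theorem theorem2p3: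
  fixes P Q :: "'n::finite rel"
  assumes "CARD('n) \<ge> 2"
    and "partial_order_on UNIV P" and "partial_order_on UNIV Q"
    and "common_linear_extension P Q"
  shows "(Q_factorial_fano (\<Gamma> P Q) \<longleftrightarrow> smooth_fano (\<Gamma> P Q)) \<and>
    (smooth_fano (\<Gamma> P Q) \<longleftrightarrow>
      (\<exists>i. index_permutation i \<and>
         (nonempty_ideals P = initial_segments i \<or> nonempty_ideals P = initial_segments' i) \<and>
         (nonempty_ideals Q = initial_segments i \<or> nonempty_ideals Q = initial_segments' i)))"
    (is "_ \<and> (_ \<longleftrightarrow> ?R)")
proof -
  have "?R" if "Q_factorial_fano (\<Gamma> P Q) \<or> smooth_fano (\<Gamma> P Q)"
  proof -
    have S: "simplicial_polytope (\<Gamma> P Q) \<or> smooth_fano (\<Gamma> P Q)"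
      using that by (auto simp: Q_factorial_fano_def)
    \<comment> \<open>A single permutation has to serve both posets, and the common linear extension
      provides it.\<close>
    obtain j where j: "index_permutation j"
      and ext: "\<And>a b. \<lbrakk>a \<in> {1..CARD('n)}; b \<in> {1..CARD('n)};
        (j a, j b) \<in> P \<and> j a \<noteq> j b \<or> (j a, j b) \<in> Q \<and> j a \<noteq> j b\<rbrakk> \<Longrightarrow> a < b"
      using assms(4) unfolding common_linear_extension_def by blast
    have "nonempty_ideals P = initial_segments j \<or> nonempty_ideals P = initial_segments' j"
      by (rule laminar_ideals_classification[OF assms(1) j _ \<Gamma>_laminar(1)[OF S]]) (use ext in blast)+
    moreover have "nonempty_ideals Q = initial_segments j \<or> nonempty_ideals Q = initial_segments' j"
      by (rule laminar_ideals_classification[OF assms(1) j _ \<Gamma>_laminar(2)[OF S]]) (use ext in blast)+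
    ultimately show ?thesis using j by blast
  qed
  moreover have "Q_factorial_fano (\<Gamma> P Q) \<and> smooth_fano (\<Gamma> P Q)" if "?R"
    using that \<Gamma>_initial_segments[OF assms(1)] by blast
  ultimately show ?thesis by blast
qed

end
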